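(* Let $A$ be a commutative MVW-rig with unitary element. Then $\mathrm{Spec}(A)$, equipped with the co-Zariski topology, is a compact topological space (every open cover has a finite subcover; no separation axiom is included).
   Context: An MV-algebra is a set $A$ with a binary operation $\oplus$, a unary operation $\neg$ and a constant $0$ such that for all $x,y,z\in A$: $x\oplus(y\oplus z)=(x\oplus y)\oplus z$; $x\oplus y=y\oplus x$; $x\oplus 0=x$; $x\oplus\neg 0=\neg 0$; $\neg\neg x=x$; $\neg(\neg x\oplus y)\oplus y=\neg(\neg y\oplus x)\oplus x$. Put $u=\neg 0$, $x\ominus y=\neg(\neg x\oplus y)$, and $x\le y$ iff $x\ominus y=0$; this is a lattice order with minimum $0$ and maximum $u$. An MVW-rig is a structure $(A,\oplus,\cdot,\neg,0)$ such that $(A,\oplus,\neg,0)$ is an MV-algebra, $\cdot$ is an associative binary operation on $A$ (written $ab$), and for all $a,b,c\in A$: $a0=0a=0$; $a(b\oplus c)\le ab\oplus ac$ and $(b\oplus c)a\le ba\oplus ca$; $a(b\ominus c)\ge ab\ominus ac$ and $(b\ominus c)a\ge ba\ominus ca$. It is commutative if $xy=yx$ for all $x,y\in A$; a unitary element is an element $1$ with $1x=x1=x$ for all $x\in A$ (not necessarily equal to $u$). An ideal of $A$ is a subset $I\subseteq A$ with $0\in I$; $a\le b$ and $b\in I$ imply $a\in I$; $a,b\in I$ imply $a\oplus b\in I$; $a\in I$ and $b\in A$ imply $ab,ba\in I$. A prime ideal is a proper ideal $P\neq A$ such that $ab\in P$ implies $a\in P$ or $b\in P$. $\mathrm{Spec}(A)$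 is the set of prime ideals of $A$, and for $a\in A$, $V(a)=\{P\in\mathrm{Spec}(A)\mid a\in P\}$. The co-Zariski topology on $\mathrm{Spec}(A)$ is the topology having $\{V(a)\}_{a\in A}$ as a base of open sets. *)

theory Defs
  imports "HOL-Analysis.Abstract_Topology"
begin

locale mv_algebra =
  fixes A :: "'a set"
    and oplus :: "'a \<Rightarrow> 'a \<Rightarrow> 'a"  (infixl "\<oplus>" 65)
    and neg :: "'a \<Rightarrow> 'a"
    and zero :: 'a  ("\<zero>")
  assumes zero_closed: "\<zero> \<in> A"
    and oplus_closed: "\<lbrakk>x \<in> A; y \<in> A\<rbrakk> \<Longrightarrow> x \<oplus> y \<in> A"
    and neg_closed: "x \<in> A \<Longrightarrow> neg x \<in> A"
    and oplus_assoc: "\<lbrakk>x \<in> A; y \<in> A; z \<in> A\<rbrakk> \<Longrightarrow> x \<oplus> (y \<oplus> z) = (x \<oplus> y) \<oplus> z"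
    and oplus_comm: "\<lbrakk>x \<in> A; y \<in> A\<rbrakk> \<Longrightarrow> x \<oplus> y = y \<oplus> x"
    and oplus_zero: "x \<in> A \<Longrightarrow> x \<oplus> \<zero> = x"
    and oplus_neg_zero: "x \<in> A \<Longrightarrow> x \<oplus> neg \<zero> = neg \<zero>"
    and neg_neg: "x \<in> A \<Longrightarrow> neg (neg x) = x"
    and lukasiewicz: "\<lbrakk>x \<in> A; y \<in> A\<rbrakk> \<Longrightarrow> neg (neg x \<oplus> y) \<oplus> y = neg (neg y \<oplus> x) \<oplus> x"
begin

definition ominus :: "'a \<Rightarrow> 'a \<Rightarrow> 'a"  (infixl "\<ominus>" 65)
  where "x \<ominus> y = neg (neg x \<oplus> y)"

definition leq :: "'a \<Rightarrow> 'a \<Rightarrow> bool"  (infix "\<preceq>" 50)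
  where "x \<preceq> y \<longleftrightarrow> x \<ominus> y = \<zero>"

lemma neg_oplus_self:
  assumes "x \<in> A"
  shows "neg x \<oplus> x = neg \<zero>"
proof -
  have "neg (neg x \<oplus> neg \<zero>) \<oplus> neg \<zero> = neg (neg (neg \<zero>) \<oplus> x) \<oplus> x"
    using assms by (intro lukasiewicz neg_closed zero_closed)
  moreover have "neg (neg \<zero>) \<oplus> x = x"
    using assms oplus_comm[of "\<zero>" x] by (simp add: oplus_zero neg_neg zero_closed)
  moreover have "neg (neg x \<oplus> neg \<zero>) \<oplus> neg \<zero> = neg \<zero>"
    using assms by (intro oplus_neg_zero neg_closed oplus_closed zero_closed)
  ultimately show ?thesis
    by simp
qed

lemma leq_oplus_left:
  assumes "x \<in> A" "y \<in> A"
  shows "x \<preceq> x \<oplus> y"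
proof -
  have "neg x \<oplus> (x \<oplus> y) = neg \<zero> \<oplus> y"
    using assms by (simp add: oplus_assoc neg_closed neg_oplus_self)
  also have "\<dots> = y \<oplus> neg \<zero>"
    using assms by (intro oplus_comm neg_closed zero_closed)
  also have "\<dots> = neg \<zero>"
    using assms by (simp add: oplus_neg_zero)
  finally have "neg x \<oplus> (x \<oplus> y) = neg \<zero>" .
  then show ?thesis
    using neg_neg zero_closed by (simp add: leq_def ominus_def)
qed

end

locale mvw_rig = mv_algebra A oplus neg zero
  for A :: "'a set"
    and oplus :: "'a \<Rightarrow> 'a \<Rightarrow> 'a"  (infixl "\<oplus>" 65)
    and neg :: "'a \<Rightarrow> 'a"
    and zero :: 'a  ("\<zero>") +
  fixes mult :: "'a \<Rightarrow> 'a \<Rightarrow> 'a"  (infixl "\<cdot>" 70)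
  assumes mult_closed: "\<lbrakk>a \<in> A; b \<in> A\<rbrakk> \<Longrightarrow> a \<cdot> b \<in> A"
    and mult_assoc: "\<lbrakk>a \<in> A; b \<in> A; c \<in> A\<rbrakk> \<Longrightarrow> (a \<cdot> b) \<cdot> c = a \<cdot> (b \<cdot> c)"
    and mult_zero: "a \<in> A \<Longrightarrow> a \<cdot> \<zero> = \<zero>"
    and zero_mult: "a \<in> A \<Longrightarrow> \<zero> \<cdot> a = \<zero>"
    and mult_oplus: "\<lbrakk>a \<in> A; b \<in> A; c \<in> A\<rbrakk> \<Longrightarrow> a \<cdot> (b \<oplus> c) \<preceq> a \<cdot> b \<oplus> a \<cdot> c"
    and oplus_mult: "\<lbrakk>a \<in> A; b \<in> A; c \<in> A\<rbrakk> \<Longrightarrow> (b \<oplus> c) \<cdot> a \<preceq> b \<cdot> a \<oplus> c \<cdot> a"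
    and mult_ominus: "\<lbrakk>a \<in> A; b \<in> A; c \<in> A\<rbrakk> \<Longrightarrow> a \<cdot> b \<ominus> a \<cdot> c \<preceq> a \<cdot> (b \<ominus> c)"
    and ominus_mult: "\<lbrakk>a \<in> A; b \<in> A; c \<in> A\<rbrakk> \<Longrightarrow> b \<cdot> a \<ominus> c \<cdot> a \<preceq> (b \<ominus> c) \<cdot> a"
begin

definition ideal :: "'a set \<Rightarrow> bool"
  where "ideal I \<longleftrightarrow> I \<subseteq> A \<and> \<zero> \<in> I
    \<and> (\<forall>a\<in>A. \<forall>b\<in>I. a \<preceq> b \<longrightarrow> a \<in> I)
    \<and> (\<forall>a\<in>I. \<forall>b\<in>I. a \<oplus> b \<in> I)
    \<and> (\<forall>a\<in>I. \<forall>b\<in>A. a \<cdot> b \<in> I \<and> b \<cdot> a \<in> I)"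

definition prime_ideal :: "'a set \<Rightarrow> bool"
  where "prime_ideal P \<longleftrightarrow> ideal P \<and> P \<noteq> A
    \<and> (\<forall>a\<in>A. \<forall>b\<in>A. a \<cdot> b \<in> P \<longrightarrow> a \<in> P \<or> b \<in> P)"

definition Spec :: "'a set set"
  where "Spec = {P. prime_ideal P}"

definition V :: "'a \<Rightarrow> 'a set set"
  where "V a = {P \<in> Spec. a \<in> P}"

definition co_zariski :: "'a set topology"
  where "co_zariski = topology (arbitrary union_of (\<lambda>U. \<exists>a\<in>A. U = V a))"

lemma V_zero: "V \<zero> = Spec"
  by (auto simp: V_def Spec_def prime_ideal_def ideal_def)

lemma V_oplus:
  assumes "a \<in> A" "b \<in> A"
  shows "V (a \<oplus> b) = V a \<inter> V b"
proof -
  have "a \<preceq> a \<oplus> b" "b \<preceq> a \<oplus> b"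
    using assms leq_oplus_left[of a b] leq_oplus_left[of b a] oplus_comm[of b a] by simp_all
  then have "a \<oplus> b \<in> P \<longleftrightarrow> a \<in> P \<and> b \<in> P" if "ideal P" for P
    using assms that unfolding ideal_def by blast
  then show ?thesis
    by (auto simp: V_def Spec_def prime_ideal_def)
qed

text \<open>The sets \<open>V a\<close> are closed under binary intersection, so they do form a base and
  \<^const>\<open>topology\<close> is applied to a genuine topology.\<close>

lemma openin_co_zariski: "openin co_zariski = arbitrary union_of (\<lambda>U. \<exists>a\<in>A. U = V a)"
proof -
  have "istopology (arbitrary union_of (\<lambda>U. \<exists>a\<in>A. U = V a))"
  proof (rule istopology_base)
    fix S T
    assume "\<exists>a\<in>A. S = V a" "\<exists>a\<in>A. T = V a"
    then obtain a b where "a \<in> A" "b \<in> A" "S = V a" "T = V b"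
      by blast
    then have "S \<inter> T = V (a \<oplus> b)" "a \<oplus> b \<in> A"
      by (simp_all add: V_oplus oplus_closed)
    then show "\<exists>a\<in>A. S \<inter> T = V a"
      by blast
  qed
  then show ?thesis
    by (simp add: co_zariski_def)
qed

lemma topspace_co_zariski: "topspace co_zariski = Spec"
proof
  show "topspace co_zariski \<subseteq> Spec"
    unfolding topspace_def openin_co_zariski union_of_def V_def by blast
  have "\<exists>a\<in>A. Spec = V a"
    using V_zero zero_closed by blast
  then have "openin co_zariski Spec"
    unfolding openin_co_zariski by (rule arbitrary_union_of_inc)
  then show "Spec \<subseteq> topspace co_zariski"
    by (rule openin_subset)
qed

end

end

theory Submission
  imports Defs
begin

text \<open>Given a family \<open>\<U>\<close> of open sets covering the primes above an ideal \<open>I\<close>, let \<open>S\<close> be the set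
  of all \<open>s\<close> such that \<open>V s\<close> is covered by finitely many members of \<open>\<U>\<close>. It is multiplicatively
  closed, because \<open>V (s t) \<subseteq> V s \<union> V t\<close>, and it contains the unitary element. If some \<open>s \<in> S\<close> lies
  in \<open>I\<close>, then \<open>V s\<close> contains all primes above \<open>I\<close>, which are therefore finitely covered. Otherwise
  an ideal that is maximal among those containing \<open>I\<close> and disjoint from \<open>S\<close> is prime; it lies in some
  basic open set \<open>V a\<close> contained in a member of \<open>\<U>\<close>, so that \<open>a\<close> belongs both to it and to \<open>S\<close>, which
  is absurd. Compactness of the spectrum is the case \<open>I = {0}\<close>.\<close>

definition finitely_covered :: "'b set set \<Rightarrow> 'b set \<Rightarrow> bool"
  where "finitely_covered \<U> X \<longleftrightarrow> (\<exists>\<F>. finite \<F> \<and> \<F> \<subseteq> \<U> \<and> X \<subseteq> \<Union>\<F>)"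

lemma finitely_covered_subset:
  assumes "finitely_covered \<U> Y" "X \<subseteq> Y"
  shows "finitely_covered \<U> X"
  using assms unfolding finitely_covered_def by (meson subset_trans)

lemma finitely_covered_empty: "finitely_covered \<U> {}"
  unfolding finitely_covered_def by (meson empty_subsetI finite.emptyI)

lemma finitely_covered_member:
  assumes "U \<in> \<U>"
  shows "finitely_covered \<U> U"
  unfolding finitely_covered_def using assms by (intro exI[of _ "{U}"]) simp

lemma finitely_covered_Un:
  assumes "finitely_covered \<U> X" "finitely_covered \<U> Y"
  shows "finitely_covered \<U> (X \<union> Y)"
proof -
  obtain \<F> \<G> where "finite \<F>" "\<F> \<subseteq> \<U>" "X \<subseteq> \<Union>\<F>" "finite \<G>" "\<G> \<subseteq> \<U>" "Y \<subseteq> \<Union>\<G>"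
    using assms unfolding finitely_covered_def by blast
  then show ?thesis
    unfolding finitely_covered_def by (intro exI[of _ "\<F> \<union> \<G>"]) auto
qed

lemma compactin_iff_finitely_covered:
  "compactin X S \<longleftrightarrow>
    S \<subseteq> topspace X \<and> (\<forall>\<U>. (\<forall>U\<in>\<U>. openin X U) \<and> S \<subseteq> \<Union>\<U> \<longrightarrow> finitely_covered \<U> S)"
  by (simp add: compactin_def finitely_covered_def)

context mv_algebra
begin

lemma ominus_closed:
  assumes "x \<in> A" "y \<in> A"
  shows "x \<ominus> y \<in> A"
  using assms by (simp add: ominus_def neg_closed oplus_closed)

lemma leq_zero_iff:
  assumes "x \<in> A"
  shows "x \<preceq> \<zero> \<longleftrightarrow> x = \<zero>"
  using assms by (simp add: leq_def ominus_def oplus_zero neg_closed neg_neg)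

end

context mvw_rig
begin

lemma mult_right_mono:
  assumes "x \<in> A" "y \<in> A" "z \<in> A" "x \<preceq> y"
  shows "x \<cdot> z \<preceq> y \<cdot> z"
proof -
  have "x \<cdot> z \<ominus> y \<cdot> z \<preceq> (x \<ominus> y) \<cdot> z"
    using assms by (intro ominus_mult)
  also have "(x \<ominus> y) \<cdot> z = \<zero>"
    using assms by (simp add: leq_def zero_mult)
  finally have "x \<cdot> z \<ominus> y \<cdot> z = \<zero>"
    using assms by (simp add: leq_zero_iff ominus_closed mult_closed)
  then show ?thesis
    by (simp add: leq_def)
qed

lemma idealI:
  assumes "I \<subseteq> A" "\<zero> \<in> I"
    and "\<And>a b. \<lbrakk>a \<in> A; b \<in> I; a \<preceq> b\<rbrakk> \<Longrightarrow> a \<in> I"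
    and "\<And>a b. \<lbrakk>a \<in> I; b \<in> I\<rbrakk> \<Longrightarrow> a \<oplus> b \<in> I"
    and "\<And>a b. \<lbrakk>a \<in> I; b \<in> A\<rbrakk> \<Longrightarrow> a \<cdot> b \<in> I"
    and "\<And>a b. \<lbrakk>a \<in> I; b \<in> A\<rbrakk> \<Longrightarrow> b \<cdot> a \<in> I"
  shows "ideal I"
  unfolding ideal_def using assms by simp

lemma
  assumes "ideal I"
  shows ideal_subset: "I \<subseteq> A"
    and ideal_zero_mem: "\<zero> \<in> I"
    and ideal_leq_mem: "\<lbrakk>a \<in> A; b \<in> I; a \<preceq> b\<rbrakk> \<Longrightarrow> a \<in> I"
    and ideal_oplus_mem: "\<lbrakk>a \<in> I; b \<in> I\<rbrakk> \<Longrightarrow> a \<oplus> b \<in> I"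
    and ideal_mult_right_mem: "\<lbrakk>a \<in> I; b \<in> A\<rbrakk> \<Longrightarrow> a \<cdot> b \<in> I"
    and ideal_mult_left_mem: "\<lbrakk>a \<in> I; b \<in> A\<rbrakk> \<Longrightarrow> b \<cdot> a \<in> I"
  using assms unfolding ideal_def by blast+

lemma ideal_zero: "ideal {\<zero>}"
  by (rule idealI) (simp_all add: zero_closed leq_zero_iff oplus_zero mult_zero zero_mult)

lemma ideal_Union_directed:
  assumes "\<C> \<noteq> {}" and ideals: "\<And>I. I \<in> \<C> \<Longrightarrow> ideal I"
    and directed: "\<And>I J. \<lbrakk>I \<in> \<C>; J \<in> \<C>\<rbrakk> \<Longrightarrow> \<exists>K\<in>\<C>. I \<subseteq> K \<and> J \<subseteq> K"
  shows "ideal (\<Union>\<C>)"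
proof (rule idealI)
  show "\<Union>\<C> \<subseteq> A" "\<zero> \<in> \<Union>\<C>"
    using assms(1) ideals ideal_subset ideal_zero_mem by blast+
  show "a \<in> \<Union>\<C>" if "a \<in> A" "b \<in> \<Union>\<C>" "a \<preceq> b" for a b
    using that ideals ideal_leq_mem by blast
  show "a \<cdot> b \<in> \<Union>\<C>" "b \<cdot> a \<in> \<Union>\<C>" if "a \<in> \<Union>\<C>" "b \<in> A" for a b
    using that ideals ideal_mult_right_mem ideal_mult_left_mem by blast+
  show "a \<oplus> b \<in> \<Union>\<C>" if ab: "a \<in> \<Union>\<C>" "b \<in> \<Union>\<C>" for a b
  proof -
    obtain I J where "I \<in> \<C>" "a \<in> I" "J \<in> \<C>" "b \<in> J"
      using ab by blast
    moreover obtain K where "K \<in> \<C>" "I \<subseteq> K" "J \<subseteq> K"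
      using \<open>I \<in> \<C>\<close> \<open>J \<in> \<C>\<close> directed by blast
    ultimately have "K \<in> \<C>" "a \<in> K" "b \<in> K"
      by blast+
    then show ?thesis
      using ideals ideal_oplus_mem by blast
  qed
qed

lemma ideal_eq_carrier_if_left_unit_mem:
  assumes "ideal I" "e \<in> I" and "\<And>x. x \<in> A \<Longrightarrow> e \<cdot> x = x"
  shows "I = A"
proof
  show "I \<subseteq> A"
    using assms(1) by (rule ideal_subset)
  show "A \<subseteq> I"
    using ideal_mult_right_mem[OF assms(1,2)] assms(3) by fastforce
qed

lemma V_left_unit:
  assumes "\<And>x. x \<in> A \<Longrightarrow> e \<cdot> x = x"
  shows "V e = {}"
  using ideal_eq_carrier_if_left_unit_mem assms by (auto simp: V_def Spec_def prime_ideal_def)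

lemma V_mult_subset:
  assumes "a \<in> A" "b \<in> A"
  shows "V (a \<cdot> b) \<subseteq> V a \<union> V b"
  using assms unfolding V_def Spec_def prime_ideal_def by blast

lemma openin_co_zariskiE:
  assumes "openin co_zariski U" "P \<in> U"
  obtains a where "a \<in> A" "P \<in> V a" "V a \<subseteq> U"
proof -
  have "\<exists>a\<in>A. P \<in> V a \<and> V a \<subseteq> U"
    using assms unfolding openin_co_zariski union_of_def by blast
  then show thesis
    using that by blast
qed

definition multiplicative_set :: "'a set \<Rightarrow> bool"
  where "multiplicative_set S \<longleftrightarrow> S \<subseteq> A \<and> S \<noteq> {} \<and> (\<forall>s\<in>S. \<forall>t\<in>S. s \<cdot> t \<in> S)"

lemma multiplicative_set_finitely_covered:
  assumes "e \<in> A" "\<And>x. x \<in> A \<Longrightarrow> e \<cdot> x = x"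
  shows "multiplicative_set {s \<in> A. finitely_covered \<U> (V s)}" (is "multiplicative_set ?S")
  unfolding multiplicative_set_def
proof (intro conjI ballI)
  show "?S \<subseteq> A"
    by blast
  have "e \<in> ?S"
    using assms by (simp add: V_left_unit finitely_covered_empty)
  then show "?S \<noteq> {}"
    by blast
  fix s t assume "s \<in> ?S" "t \<in> ?S"
  then have "s \<in> A" "t \<in> A" "finitely_covered \<U> (V s \<union> V t)"
    by (simp_all add: finitely_covered_Un)
  then show "s \<cdot> t \<in> ?S"
    using finitely_covered_subset[OF _ V_mult_subset] by (simp add: mult_closed)
qed

definition maximal_disjoint_ideal :: "'a set \<Rightarrow> 'a set \<Rightarrow> bool"
  where "maximal_disjoint_ideal S P \<longleftrightarrow> ideal P \<and> P \<inter> S = {}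
    \<and> (\<forall>J. ideal J \<and> P \<subseteq> J \<and> J \<inter> S = {} \<longrightarrow> J = P)"

lemma maximal_disjoint_ideal_exists:
  assumes "ideal I" "I \<inter> S = {}"
  obtains P where "maximal_disjoint_ideal S P" "I \<subseteq> P"
proof -
  let ?\<I> = "{J. ideal J \<and> I \<subseteq> J \<and> J \<inter> S = {}}"
  have "\<exists>P\<in>?\<I>. \<forall>J\<in>?\<I>. P \<subseteq> J \<longrightarrow> J = P"
  proof (rule subset_Zorn_nonempty)
    show "?\<I> \<noteq> {}"
      using assms by blast
  next
    fix \<C> assume "\<C> \<noteq> {}" and "subset.chain ?\<I> \<C>"
    then have members: "\<C> \<subseteq> ?\<I>" and chain: "\<And>J K. \<lbrakk>J \<in> \<C>; K \<in> \<C>\<rbrakk> \<Longrightarrow> J \<subseteq> K \<or> K \<subseteq> J"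
      by (auto simp: subset_chain_def)
    have "ideal (\<Union>\<C>)"
    proof (rule ideal_Union_directed[OF \<open>\<C> \<noteq> {}\<close>])
      show "ideal J" if "J \<in> \<C>" for J
        using that members by blast
      show "\<exists>L\<in>\<C>. J \<subseteq> L \<and> K \<subseteq> L" if "J \<in> \<C>" "K \<in> \<C>" for J K
        using that chain[OF that] by blast
    qed
    then show "\<Union>\<C> \<in> ?\<I>"
      using \<open>\<C> \<noteq> {}\<close> members by blast
  qed
  then obtain P where "P \<in> ?\<I>" and "\<forall>J\<in>?\<I>. P \<subseteq> J \<longrightarrow> J = P"
    by (rule bexE)
  then have "maximal_disjoint_ideal S P" "I \<subseteq> P"
    unfolding maximal_disjoint_ideal_def by blast+
  then show thesis
    by (rule that)
qed

end

locale comm_mvw_rig = mvw_rig +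
  assumes mult_comm: "\<lbrakk>x \<in> A; y \<in> A\<rbrakk> \<Longrightarrow> x \<cdot> y = y \<cdot> x"
begin

definition colon :: "'a set \<Rightarrow> 'a \<Rightarrow> 'a set"
  where "colon I b = {x \<in> A. x \<cdot> b \<in> I}"

lemma subset_colon:
  assumes "ideal I" "b \<in> A"
  shows "I \<subseteq> colon I b"
  using ideal_subset[OF assms(1)] ideal_mult_right_mem[OF assms(1) _ assms(2)]
  unfolding colon_def by blast

lemma ideal_colon:
  assumes I: "ideal I" and b: "b \<in> A"
  shows "ideal (colon I b)"
proof (rule idealI)
  show "colon I b \<subseteq> A" "\<zero> \<in> colon I b"
    using b ideal_zero_mem[OF I] by (auto simp: colon_def zero_closed zero_mult)
  show "x \<in> colon I b" if "x \<in> A" "y \<in> colon I b" "x \<preceq> y" for x y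
    using that b ideal_leq_mem[OF I mult_closed _ mult_right_mono] unfolding colon_def by blast
  show "x \<oplus> y \<in> colon I b" if "x \<in> colon I b" "y \<in> colon I b" for x y
    using that b ideal_leq_mem[OF I mult_closed ideal_oplus_mem[OF I] oplus_mult] oplus_closed
    unfolding colon_def by blast
  show mult_left: "c \<cdot> x \<in> colon I b" if "x \<in> colon I b" "c \<in> A" for x c
    using that b ideal_mult_left_mem[OF I] by (simp add: colon_def mult_assoc mult_closed)
  show "x \<cdot> c \<in> colon I b" if "x \<in> colon I b" "c \<in> A" for x c
    using that mult_left[of x c] mult_comm[of x c] by (simp add: colon_def)
qed

lemma maximal_disjoint_ideal_mult_memE:
  assumes P: "maximal_disjoint_ideal S P" and "x \<in> A" "y \<in> A" "x \<cdot> y \<in> P" "x \<notin> P"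
  obtains s where "s \<in> S" "s \<in> A" "s \<cdot> y \<in> P"
proof -
  have "ideal P"
    using P by (simp add: maximal_disjoint_ideal_def)
  \<comment> \<open>Applying maximality to colon ideals avoids describing the ideal generated by
    \<open>P\<close> and an element.\<close>
  moreover have "colon P y \<noteq> P"
    using assms by (auto simp: colon_def)
  ultimately have "colon P y \<inter> S \<noteq> {}"
    using P ideal_colon[of P y] subset_colon[of P y] \<open>y \<in> A\<close>
    unfolding maximal_disjoint_ideal_def by blast
  then show thesis
    using that by (auto simp: colon_def)
qed

lemma prime_ideal_if_maximal_disjoint:
  assumes P: "maximal_disjoint_ideal S P" and S: "multiplicative_set S"
  shows "prime_ideal P"
  unfolding prime_ideal_def
proof (intro conjI ballI impI)
  have disjoint: "P \<inter> S = {}"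
    using P by (simp add: maximal_disjoint_ideal_def)
  show "ideal P"
    using P by (simp add: maximal_disjoint_ideal_def)
  show "P \<noteq> A"
    using S disjoint unfolding multiplicative_set_def by blast
  fix a b assume "a \<in> A" "b \<in> A" "a \<cdot> b \<in> P"
  show "a \<in> P \<or> b \<in> P"
  proof (rule ccontr)
    assume "\<not> (a \<in> P \<or> b \<in> P)"
    then have "a \<notin> P" "b \<notin> P"
      by simp_all
    obtain s where s: "s \<in> S" "s \<in> A" "s \<cdot> b \<in> P"
      using maximal_disjoint_ideal_mult_memE[OF P \<open>a \<in> A\<close> \<open>b \<in> A\<close> \<open>a \<cdot> b \<in> P\<close> \<open>a \<notin> P\<close>] .
    then have "b \<cdot> s \<in> P"
      using mult_comm \<open>b \<in> A\<close> by simp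
    then obtain t where "t \<in> S" "t \<cdot> s \<in> P"
      using maximal_disjoint_ideal_mult_memE[OF P \<open>b \<in> A\<close> \<open>s \<in> A\<close> _ \<open>b \<notin> P\<close>] by blast
    then show False
      using S s(1) disjoint unfolding multiplicative_set_def by blast
  qed
qed

lemma prime_ideal_separation:
  assumes "ideal I" "multiplicative_set S" "I \<inter> S = {}"
  obtains P where "prime_ideal P" "I \<subseteq> P" "P \<inter> S = {}"
proof -
  obtain P where P: "maximal_disjoint_ideal S P" "I \<subseteq> P"
    using assms(1,3) by (rule maximal_disjoint_ideal_exists)
  moreover have "P \<inter> S = {}"
    using P(1) by (simp add: maximal_disjoint_ideal_def)
  ultimately show thesis
    using that prime_ideal_if_maximal_disjoint assms(2) by blast
qed

lemma compactin_primes_containing_ideal: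
  assumes I: "ideal I" and unit: "e \<in> A" "\<And>x. x \<in> A \<Longrightarrow> e \<cdot> x = x"
  shows "compactin co_zariski {P \<in> Spec. I \<subseteq> P}"
  unfolding compactin_iff_finitely_covered topspace_co_zariski
proof (intro conjI allI impI)
  show "{P \<in> Spec. I \<subseteq> P} \<subseteq> Spec"
    by blast
  fix \<U> assume "(\<forall>U\<in>\<U>. openin co_zariski U) \<and> {P \<in> Spec. I \<subseteq> P} \<subseteq> \<Union>\<U>"
  then have opens: "\<And>U. U \<in> \<U> \<Longrightarrow> openin co_zariski U"
    and cover: "{P \<in> Spec. I \<subseteq> P} \<subseteq> \<Union>\<U>"
    by blast+
  let ?S = "{s \<in> A. finitely_covered \<U> (V s)}"
  have "I \<inter> ?S \<noteq> {}"
  proof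
    assume "I \<inter> ?S = {}"
    then obtain P where P: "prime_ideal P" "I \<subseteq> P" "P \<inter> ?S = {}"
      using prime_ideal_separation[OF I multiplicative_set_finitely_covered[OF unit]] by blast
    then obtain U where U: "U \<in> \<U>" "P \<in> U"
      using cover by (auto simp: Spec_def)
    then obtain a where a: "a \<in> A" "P \<in> V a" "V a \<subseteq> U"
      using opens openin_co_zariskiE by blast
    then have "finitely_covered \<U> (V a)"
      using finitely_covered_member[OF U(1)] finitely_covered_subset by blast
    moreover have "a \<in> P"
      using a(2) by (simp add: V_def)
    ultimately show False
      using P(3) a(1) by blast
  qed
  then obtain s where "s \<in> I" "finitely_covered \<U> (V s)"
    by blast
  moreover have "{P \<in> Spec. I \<subseteq> P} \<subseteq> V s"
    using \<open>s \<in> I\<close> by (auto simp: V_def)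
  ultimately show "finitely_covered \<U> {P \<in> Spec. I \<subseteq> P}"
    using finitely_covered_subset by blast
qed

theorem compact_space_co_zariski:
  assumes "e \<in> A" "\<And>x. x \<in> A \<Longrightarrow> e \<cdot> x = x"
  shows "compact_space co_zariski"
proof -
  have "{P \<in> Spec. {\<zero>} \<subseteq> P} = Spec"
    using V_zero by (simp add: V_def)
  then show ?thesis
    using compactin_primes_containing_ideal[OF ideal_zero assms]
    by (simp add: compact_space_def topspace_co_zariski)
qed

end

theorem theorem60:
  fixes A :: "'a set"
    and oplus mult :: "'a \<Rightarrow> 'a \<Rightarrow> 'a"
    and neg :: "'a \<Rightarrow> 'a"
    and zero one :: 'a
  assumes "mvw_rig A oplus neg zero mult"
    and "\<And>x y. \<lbrakk>x \<in> A; y \<in> A\<rbrakk> \<Longrightarrow> mult x y = mult y x"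
    and "one \<in> A"
    and "\<And>x. x \<in> A \<Longrightarrow> mult one x = x \<and> mult x one = x"
  shows "compact_space (mvw_rig.co_zariski A oplus neg zero mult)"
proof -
  interpret mvw_rig A oplus neg zero mult
    by (fact assms(1))
  interpret comm_mvw_rig A oplus neg zero mult
    by unfold_locales (fact assms(2))
  show ?thesis
    using assms(3,4) by (intro compact_space_co_zariski[of one]) simp_all
qed

end
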